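(* Let $m\ge 2$ and let $f_i\colon\mathbb{R}^n\to(-\infty,\infty]$, $i=1,\ldots,m$, be convex functions satisfying $$\bigcap_{i=1}^m\mathrm{ri}\big(\mathrm{dom}(f_i)\big)\neq\emptyset.$$ Then for all $\bar{x}\in\bigcap_{i=1}^m\mathrm{dom}(f_i)$ we have $$\partial\Big(\sum_{i=1}^m f_i\Big)(\bar{x})=\sum_{i=1}^m\partial f_i(\bar{x}).$$
   Context: For $f\colon\mathbb{R}^n\to(-\infty,\infty]$, $\mathrm{dom}(f):=\{x : f(x)<\infty\}$. For a convex $f$ and $\bar{x}\in\mathrm{dom}(f)$, the subdifferential is $\partial f(\bar{x}):=\{v\in\mathbb{R}^n : f(x)\ge f(\bar{x})+\langle v,x-\bar{x}\rangle\text{ for all }x\in\mathbb{R}^n\}$. For a convex set $\Omega$, the relative interior $\mathrm{ri}(\Omega)$ is the set of $x\in\Omega$ for which there is $\gamma>0$ with $\mathbb{B}(x;\gamma)\cap\mathrm{aff}(\Omega)\subset\Omega$ (closed ball, affine hull). The sum of sets is the Minkowski sum (empty if one of the summands is empty). *)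

theory Defs
  imports "HOL-Analysis.Analysis"
begin

definition effective_domain :: "('a \<Rightarrow> ereal) \<Rightarrow> 'a set"
  where "effective_domain f = {x. f x < \<infinity>}"

text \<open>
  The functions of interest take values in \<open>(-\<infinity>, \<infinity>]\<close>; the exclusion of \<open>-\<infinity>\<close> is a separate
  hypothesis where it is needed. The weight \<open>t\<close> ranges over the open interval \<open>(0, 1)\<close>, so that
  products \<open>0 * \<infinity>\<close> never occur.
\<close>

definition convex_ereal :: "('a::real_vector \<Rightarrow> ereal) \<Rightarrow> bool"
  where "convex_ereal f \<longleftrightarrow>
    (\<forall>x y. \<forall>t\<in>{0<..<1}. f (t *\<^sub>R x + (1 - t) *\<^sub>R y) \<le> ereal t * f x + ereal (1 - t) * f y)"

text \<open>Intended for points \<open>a\<close> of the effective domain of a convex function \<open>f\<close>.\<close>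

definition subdifferential :: "('a::real_inner \<Rightarrow> ereal) \<Rightarrow> 'a \<Rightarrow> 'a set"
  where "subdifferential f a = {v. \<forall>x. f x \<ge> f a + ereal (v \<bullet> (x - a))}"

end

theory Submission
  imports Defs
begin

text \<open>
  A sum of subgradients is a subgradient of the sum for trivial reasons. For the converse with two
  functions \<open>f\<close> and \<open>g\<close>, subtract from \<open>f\<close> the affine function given by a subgradient \<open>v\<close> of
  \<open>f + g\<close> at \<open>a\<close> (and from \<open>g\<close> the constant \<open>g a\<close>). This leaves convex functions \<open>F\<close> and \<open>G\<close>
  with \<open>F + G \<ge> 0\<close> on the common domain and \<open>F a = G a = 0\<close>; one looks for a vector \<open>u\<close> with
  \<open>F x + G y \<ge> u \<bullet> (x - y)\<close> for \<^emph>\<open>independent\<close> \<open>x\<close> and \<open>y\<close>, since setting \<open>y = a\<close> and \<open>x = a\<close> then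
  makes \<open>v + u\<close> a subgradient of \<open>f\<close> and \<open>- u\<close> one of \<open>g\<close> (\<open>subdifferential_add\<close>).

  Such a \<open>u\<close> (\<open>convex_on_decouple\<close>) comes from separating \<open>0\<close> from the convex set of all \<open>(x - y, s)\<close> with
  \<open>F x + G y < s\<close>. The point is to exclude a vertical hyperplane. A vertical normal \<open>(w, 0)\<close> gives
  \<open>w \<bullet> y \<le> w \<bullet> x\<close> for all \<open>x\<close> and \<open>y\<close> in the two domains, so at a common relative interior point
  \<open>w\<close> has its minimum over one domain and its maximum over the other, and is therefore constant on
  both. Then \<open>(w, 0)\<close> is orthogonal to the set that it separates from \<open>0\<close>; this is impossible for a
  nonzero normal in the span of that set, and the normal can always be chosen there.

  Finitely many functions are handled by induction (\<open>subdifferential_sum\<close>), because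
  the relative interior of the domain of a partial sum is the intersection of the relative interiors
  of the domains.
\<close>

section \<open>Separation of convex functions\<close>

text \<open>
  From a relative interior point \<open>z\<close> one can move a little beyond \<open>z\<close> on the ray from \<open>x\<close> and stay in
  \<open>S\<close>; if \<open>w\<close> were larger at \<open>x\<close> than at \<open>z\<close>, it would fall below its minimum there.
\<close>

lemma linear_constant_if_min_in_rel_interior:
  fixes S :: "'a::euclidean_space set"
  assumes "convex S" "z \<in> rel_interior S" "x \<in> S"
    and min: "\<And>y. y \<in> S \<Longrightarrow> w \<bullet> z \<le> w \<bullet> y"
  shows "w \<bullet> x = w \<bullet> z"
proof -
  obtain e where e: "e > 1" "(1 - e) *\<^sub>R x + e *\<^sub>R z \<in> S"
    using convex_rel_interior_iff[of S z] assms by auto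
  have "w \<bullet> z \<le> w \<bullet> ((1 - e) *\<^sub>R x + e *\<^sub>R z)"
    using min e by blast
  then have "(e - 1) * (w \<bullet> x - w \<bullet> z) \<le> 0"
    by (simp add: inner_simps algebra_simps)
  then have "w \<bullet> x \<le> w \<bullet> z"
    using e by (simp add: mult_le_0_iff)
  then show ?thesis
    using min[OF \<open>x \<in> S\<close>] by linarith
qed

text \<open>
  In the language of Fenchel duality, \<open>u\<close> is a dual certificate for the lower bound \<open>0\<close> of \<open>F + G\<close>:
  the bound survives the decoupling of the arguments of \<open>F\<close> and \<open>G\<close> at the price of a linear term in
  \<open>x - y\<close>. The common relative interior point is the constraint qualification that makes the
  separating hyperplane non-vertical.
\<close>

lemma convex_on_decouple:
  fixes A B :: "'a::euclidean_space set"
  assumes F: "convex_on A F" and G: "convex_on B G"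
    and z: "z \<in> rel_interior A" "z \<in> rel_interior B"
    and nonneg: "\<And>x. x \<in> A \<Longrightarrow> x \<in> B \<Longrightarrow> 0 \<le> F x + G x"
  obtains u where "\<And>x y. x \<in> A \<Longrightarrow> y \<in> B \<Longrightarrow> u \<bullet> (x - y) \<le> F x + G y"
proof -
  have A: "convex A" and B: "convex B"
    using F G by (auto simp: convex_on_def)
  have zA: "z \<in> A" and zB: "z \<in> B"
    using z rel_interior_subset by blast+
  \<comment> \<open>Strictness of \<open>F x + G y < s\<close> keeps \<open>0\<close> out of \<open>D\<close>; it is undone by a limit at the end.\<close>
  define D where "D = {(x - y, s) | x y s. x \<in> A \<and> y \<in> B \<and> F x + G y < s}"
  have D: "(x - y, s) \<in> D" if "x \<in> A" "y \<in> B" "F x + G y < s" for x y s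
    using that unfolding D_def by blast
  have "convex D"
  proof (rule convexI)
    fix p q :: "'a \<times> real" and t r :: real
    assume "p \<in> D" "q \<in> D" and tr: "0 \<le> t" "0 \<le> r" "t + r = 1"
    then obtain x y s x' y' s' where p: "p = (x - y, s)" "x \<in> A" "y \<in> B" "F x + G y < s"
      and q: "q = (x' - y', s')" "x' \<in> A" "y' \<in> B" "F x' + G y' < s'"
      unfolding D_def by blast
    have "F (t *\<^sub>R x + r *\<^sub>R x') \<le> t * F x + r * F x'"
      using F p q tr unfolding convex_on_def by blast
    moreover have "G (t *\<^sub>R y + r *\<^sub>R y') \<le> t * G y + r * G y'"
      using G p q tr unfolding convex_on_def by blast
    moreover have "t * (F x + G y) + r * (F x' + G y') < t * s + r * s'"
    proof (cases "t = 0")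
      case False
      then show ?thesis
        using p q tr by (intro add_less_le_mono mult_strict_left_mono mult_left_mono) auto
    qed (use q tr in simp)
    ultimately have "F (t *\<^sub>R x + r *\<^sub>R x') + G (t *\<^sub>R y + r *\<^sub>R y') < t * s + r * s'"
      by (simp add: distrib_left)
    moreover have "t *\<^sub>R x + r *\<^sub>R x' \<in> A" "t *\<^sub>R y + r *\<^sub>R y' \<in> B"
      using A B p q tr by (auto intro: convexD)
    ultimately have "((t *\<^sub>R x + r *\<^sub>R x') - (t *\<^sub>R y + r *\<^sub>R y'), t * s + r * s') \<in> D"
      by (intro D)
    then show "t *\<^sub>R p + r *\<^sub>R q \<in> D"
      by (simp add: p q algebra_simps)
  qed
  moreover have "D \<noteq> {}"
    using D[OF zA zB, of "F z + G z + 1"] by auto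
  moreover have "0 \<notin> D"
    using nonneg by (force simp: D_def zero_prod_def)
  ultimately obtain n where "n \<in> span D" "n \<noteq> 0" and n: "\<And>d. d \<in> D \<Longrightarrow> 0 \<le> n \<bullet> d"
    by (rule separating_hyperplane_set_0_inspan) blast
  obtain w c where wc: "n = (w, c)"
    by (cases n)
  have sep: "0 \<le> w \<bullet> (x - y) + c * s" if "x \<in> A" "y \<in> B" "F x + G y < s" for x y s
    using n[OF D[OF that]] by (simp add: wc)
  have "0 \<le> c"
  proof (rule ccontr)
    assume "\<not> 0 \<le> c"
    then have "c * (\<bar>F z + G z\<bar> + 1) < 0"
      by (simp add: mult_neg_pos)
    moreover have "F z + G z < \<bar>F z + G z\<bar> + 1"
      by linarith
    ultimately show False
      using sep[OF zA zB] by fastforce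
  qed
  moreover have "c \<noteq> 0"
  proof
    assume "c = 0"
    then have le: "w \<bullet> y \<le> w \<bullet> x" if "x \<in> A" "y \<in> B" for x y
      using sep[OF that, of "F x + G y + 1"] by (simp add: inner_diff_right)
    have "w \<bullet> x = w \<bullet> z" if "x \<in> A" for x
      using linear_constant_if_min_in_rel_interior[OF A z(1) that] le zB by blast
    moreover have "w \<bullet> y = w \<bullet> z" if "y \<in> B" for y
      using linear_constant_if_min_in_rel_interior[OF B z(2) that, of "- w"] le[OF zA] by simp
    ultimately have "orthogonal n d" if "d \<in> D" for d
      using that unfolding D_def by (auto simp: orthogonal_def wc \<open>c = 0\<close> inner_diff_right)
    then have "orthogonal n n"
      using orthogonal_to_span \<open>n \<in> span D\<close> by blast
    then show False
      using \<open>n \<noteq> 0\<close> by (simp add: orthogonal_def)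
  qed
  ultimately have "c > 0"
    by simp
  show thesis
  proof
    fix x y assume xy: "x \<in> A" "y \<in> B"
    show "(- (1 / c) *\<^sub>R w) \<bullet> (x - y) \<le> F x + G y"
    proof (rule field_le_epsilon)
      fix e :: real assume "0 < e"
      then show "(- (1 / c) *\<^sub>R w) \<bullet> (x - y) \<le> F x + G y + e"
        using sep[OF xy, of "F x + G y + e"] \<open>c > 0\<close> by (simp add: field_simps)
    qed
  qed
qed

section \<open>Extended-real-valued convex functions\<close>

lemma convex_effective_domain:
  assumes "convex_ereal f"
  shows "convex (effective_domain f)"
  unfolding convex_alt
proof (intro ballI allI impI, elim conjE)
  fix x y and t :: real
  assume xy: "x \<in> effective_domain f" "y \<in> effective_domain f" and t: "0 \<le> t" "t \<le> 1"
  show "(1 - t) *\<^sub>R x + t *\<^sub>R y \<in> effective_domain f"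
  proof (cases "t = 0 \<or> t = 1")
    case False
    then have "f ((1 - t) *\<^sub>R x + t *\<^sub>R y) \<le> ereal (1 - t) * f x + ereal t * f y"
      using assms t unfolding convex_ereal_def by (auto dest!: spec bspec[where x = "1 - t"])
    also have "\<dots> < \<infinity>"
      using xy t False by (cases "f x"; cases "f y") (auto simp: effective_domain_def)
    finally show ?thesis
      by (simp add: effective_domain_def)
  qed (use xy in auto)
qed

lemma ereal_real_of_effective_domain:
  assumes "\<And>x. f x \<noteq> -\<infinity>" "x \<in> effective_domain f"
  shows "ereal (real_of_ereal (f x)) = f x"
  using assms by (cases "f x") (auto simp: effective_domain_def dest: meta_spec[of _ x])

lemma convex_on_effective_domain:
  assumes f: "convex_ereal f" and nm: "\<And>x. f x \<noteq> -\<infinity>"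
  shows "convex_on (effective_domain f) (\<lambda>x. real_of_ereal (f x))"
proof (rule convex_onI)
  note dom = convex_effective_domain[OF f]
  fix t :: real and x y
  assume t: "0 < t" "t < 1" and xy: "x \<in> effective_domain f" "y \<in> effective_domain f"
  have mid: "(1 - t) *\<^sub>R x + t *\<^sub>R y \<in> effective_domain f"
    using dom t xy by (simp add: convex_alt)
  have "f ((1 - t) *\<^sub>R x + t *\<^sub>R y) \<le> ereal (1 - t) * f x + ereal t * f y"
    using f t unfolding convex_ereal_def by (auto dest!: spec bspec[where x = "1 - t"])
  then show "real_of_ereal (f ((1 - t) *\<^sub>R x + t *\<^sub>R y))
      \<le> (1 - t) * real_of_ereal (f x) + t * real_of_ereal (f y)"
    using ereal_real_of_effective_domain[of f, OF nm mid] ereal_real_of_effective_domain[of f, OF nm xy(1)]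
      ereal_real_of_effective_domain[of f, OF nm xy(2)]
    by (metis ereal_less_eq(3) plus_ereal.simps(1) times_ereal.simps(1))
qed (use convex_effective_domain[OF f] in simp)

lemma effective_domain_add:
  assumes "\<And>x. f x \<noteq> -\<infinity>" "\<And>x. g x \<noteq> -\<infinity>"
  shows "effective_domain (\<lambda>x. f x + g x) = effective_domain f \<inter> effective_domain g"
  using assms by (auto simp: effective_domain_def)

lemma sum_ereal_neq_MInfty:
  assumes "\<And>i. i \<in> I \<Longrightarrow> f i \<noteq> (-\<infinity>::ereal)"
  shows "(\<Sum>i\<in>I. f i) \<noteq> -\<infinity>"
  using assms by (induction I rule: infinite_finite_induct) auto

lemma effective_domain_sum:
  assumes "finite I" "\<And>i x. i \<in> I \<Longrightarrow> f i x \<noteq> -\<infinity>"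
  shows "effective_domain (\<lambda>x. \<Sum>i\<in>I. f i x) = (\<Inter>i\<in>I. effective_domain (f i))"
  using assms
proof (induction I)
  case empty
  show ?case by (simp add: effective_domain_def)
next
  case (insert i I)
  then show ?case
    using effective_domain_add[of "f i" "\<lambda>x. \<Sum>i\<in>I. f i x"] by (simp add: sum_ereal_neq_MInfty)
qed

lemma convex_ereal_sum:
  assumes "\<And>i. i \<in> I \<Longrightarrow> convex_ereal (f i)" "\<And>i x. i \<in> I \<Longrightarrow> f i x \<noteq> -\<infinity>"
  shows "convex_ereal (\<lambda>x. \<Sum>i\<in>I. f i x)"
  unfolding convex_ereal_def
proof (intro allI ballI)
  fix x y and t :: real assume t: "t \<in> {0<..<1}"
  have scale: "(\<Sum>i\<in>I. ereal c * f i z) = ereal c * (\<Sum>i\<in>I. f i z)" if "c > 0" for c z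
    using assms(2)
  proof (induction I rule: infinite_finite_induct)
    case (insert i I)
    then show ?case
      using sum_ereal_neq_MInfty[of I "\<lambda>i. f i z"]
      by (simp add: ereal_distrib_left)
  qed auto
  have "(\<Sum>i\<in>I. f i (t *\<^sub>R x + (1 - t) *\<^sub>R y)) \<le> (\<Sum>i\<in>I. ereal t * f i x + ereal (1 - t) * f i y)"
    using assms(1) t unfolding convex_ereal_def by (intro sum_mono) auto
  also have "\<dots> = ereal t * (\<Sum>i\<in>I. f i x) + ereal (1 - t) * (\<Sum>i\<in>I. f i y)"
    using t by (simp only: sum.distrib) (simp add: scale)
  finally show "(\<Sum>i\<in>I. f i (t *\<^sub>R x + (1 - t) *\<^sub>R y))
      \<le> ereal t * (\<Sum>i\<in>I. f i x) + ereal (1 - t) * (\<Sum>i\<in>I. f i y)" .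
qed

section \<open>The subdifferential sum rule\<close>

lemma subdifferential_add_superset:
  "subdifferential f a + subdifferential g a \<subseteq> subdifferential (\<lambda>x. f x + g x) a"
proof
  fix w assume "w \<in> subdifferential f a + subdifferential g a"
  then obtain u v where w: "w = u + v" and uv: "u \<in> subdifferential f a" "v \<in> subdifferential g a"
    by (elim set_plus_elim)
  have "f a + g a + ereal (w \<bullet> (x - a)) \<le> f x + g x" for x
  proof -
    have "f a + g a + ereal (w \<bullet> (x - a)) =
        (f a + ereal (u \<bullet> (x - a))) + (g a + ereal (v \<bullet> (x - a)))"
      by (simp add: w inner_add_left add_ac flip: plus_ereal.simps(1))
    also have "\<dots> \<le> f x + g x"
      using uv by (intro add_mono) (auto simp: subdifferential_def)
    finally show ?thesis .
  qed
  then show "w \<in> subdifferential (\<lambda>x. f x + g x) a"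
    by (simp add: subdifferential_def)
qed

text \<open>
  Subgradients can be verified by real inequalities alone, because the subgradient inequality holds
  trivially at every point where \<open>f\<close> is infinite.
\<close>

lemma subdifferentialI:
  assumes nm: "\<And>x. f x \<noteq> -\<infinity>" and a: "a \<in> effective_domain f"
    and "\<And>x. x \<in> effective_domain f \<Longrightarrow>
      real_of_ereal (f a) + v \<bullet> (x - a) \<le> real_of_ereal (f x)"
  shows "v \<in> subdifferential f a"
proof -
  have "f a + ereal (v \<bullet> (x - a)) \<le> f x" for x
  proof (cases "x \<in> effective_domain f")
    case True
    then have "ereal (real_of_ereal (f a)) + ereal (v \<bullet> (x - a)) \<le> ereal (real_of_ereal (f x))"
      using assms(3) by simp
    then show ?thesis
      by (simp only: ereal_real_of_effective_domain[of f, OF nm a] ereal_real_of_effective_domain[of f, OF nm True])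
  next
    case False
    then show ?thesis
      by (simp add: effective_domain_def)
  qed
  then show ?thesis
    by (simp add: subdifferential_def)
qed

lemma subdifferential_add:
  fixes f g :: "'a::euclidean_space \<Rightarrow> ereal"
  assumes f: "convex_ereal f" "\<And>x. f x \<noteq> -\<infinity>" and g: "convex_ereal g" "\<And>x. g x \<noteq> -\<infinity>"
    and z: "z \<in> rel_interior (effective_domain f)" "z \<in> rel_interior (effective_domain g)"
    and a: "a \<in> effective_domain f" "a \<in> effective_domain g"
  shows "subdifferential (\<lambda>x. f x + g x) a = subdifferential f a + subdifferential g a"
proof
  show "subdifferential (\<lambda>x. f x + g x) a \<subseteq> subdifferential f a + subdifferential g a"
  proof
    fix v assume v: "v \<in> subdifferential (\<lambda>x. f x + g x) a"
    define rf rg where "rf x = real_of_ereal (f x)" and "rg x = real_of_ereal (g x)" for x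
    have rf: "f x = ereal (rf x)" if "x \<in> effective_domain f" for x
      using ereal_real_of_effective_domain[of f, OF f(2) that] by (simp add: rf_def)
    have rg: "g x = ereal (rg x)" if "x \<in> effective_domain g" for x
      using ereal_real_of_effective_domain[of g, OF g(2) that] by (simp add: rg_def)
    define F where "F x = rf x + (- rf a - v \<bullet> (x - a))" for x
    define G where "G x = rg x + - rg a" for x
    have "convex_on (effective_domain f) F"
      unfolding F_def rf_def
    proof (rule convex_on_add[OF convex_on_effective_domain[OF f]])
      show "convex_on (effective_domain f) (\<lambda>x. - real_of_ereal (f a) - v \<bullet> (x - a))"
        by (rule convex_onI) (auto simp: convex_effective_domain[OF f(1)] inner_simps algebra_simps)
    qed
    moreover have "convex_on (effective_domain g) G"
      unfolding G_def rg_def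
      by (intro convex_on_add convex_on_effective_domain[OF g])
        (simp add: convex_on_const convex_effective_domain[OF g(1)])
    moreover have "0 \<le> F x + G x" if "x \<in> effective_domain f" "x \<in> effective_domain g" for x
    proof -
      have "f a + g a + ereal (v \<bullet> (x - a)) \<le> f x + g x"
        using v by (simp add: subdifferential_def)
      then show ?thesis
        by (simp add: rf rg that a F_def G_def)
    qed
    ultimately obtain u where
      u: "\<And>x y. x \<in> effective_domain f \<Longrightarrow> y \<in> effective_domain g \<Longrightarrow> u \<bullet> (x - y) \<le> F x + G y"
      using convex_on_decouple[OF _ _ z] by blast
    have "v + u \<in> subdifferential f a"
    proof (rule subdifferentialI[OF f(2) a(1)])
      fix x assume "x \<in> effective_domain f"
      from u[OF this a(2)] show "real_of_ereal (f a) + (v + u) \<bullet> (x - a) \<le> real_of_ereal (f x)"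
        by (simp add: F_def G_def rf_def inner_add_left)
    qed
    moreover have "- u \<in> subdifferential g a"
    proof (rule subdifferentialI[OF g(2) a(2)])
      fix y assume "y \<in> effective_domain g"
      from u[OF a(1) this] show "real_of_ereal (g a) + (- u) \<bullet> (y - a) \<le> real_of_ereal (g y)"
        by (simp add: F_def G_def rg_def inner_diff_right)
    qed
    ultimately have "(v + u) + (- u) \<in> subdifferential f a + subdifferential g a"
      by (rule set_plus_intro)
    then show "v \<in> subdifferential f a + subdifferential g a"
      by simp
  qed
qed (rule subdifferential_add_superset)

lemma subdifferential_zero: "subdifferential (\<lambda>x. 0) a = {0}"
proof -
  have "v = 0" if "v \<in> subdifferential (\<lambda>x. 0) a" for v
  proof -
    have "v \<bullet> ((a + v) - a) \<le> 0"
      using that unfolding subdifferential_def mem_Collect_eq by (auto dest: spec[of _ "a + v"])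
    then show ?thesis
      by (metis add_diff_cancel_left' inner_eq_zero_iff inner_ge_zero order_antisym)
  qed
  then show ?thesis
    by (auto simp: subdifferential_def zero_ereal_def)
qed

lemma subdifferential_sum:
  fixes f :: "'i \<Rightarrow> 'a::euclidean_space \<Rightarrow> ereal"
  assumes "finite I"
    and "\<And>i x. i \<in> I \<Longrightarrow> f i x \<noteq> -\<infinity>"
    and "\<And>i. i \<in> I \<Longrightarrow> convex_ereal (f i)"
    and "\<And>i. i \<in> I \<Longrightarrow> z \<in> rel_interior (effective_domain (f i))"
    and "\<And>i. i \<in> I \<Longrightarrow> a \<in> effective_domain (f i)"
  shows "subdifferential (\<lambda>x. \<Sum>i\<in>I. f i x) a = (\<Sum>i\<in>I. subdifferential (f i) a)"
  using assms
proof (induction I)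
  case empty
  show ?case
    by (simp add: subdifferential_zero)
next
  case (insert i I)
  have dom: "effective_domain (\<lambda>x. \<Sum>i\<in>I. f i x) = (\<Inter>i\<in>I. effective_domain (f i))"
    using insert by (intro effective_domain_sum) auto
  have "rel_interior (\<Inter>i\<in>I. effective_domain (f i)) = (\<Inter>i\<in>I. rel_interior (effective_domain (f i)))"
  proof -
    have "z \<in> (\<Inter>i\<in>I. rel_interior (effective_domain (f i)))"
      using insert.prems by blast
    then have "(\<Inter>i\<in>I. rel_interior (effective_domain (f i))) \<noteq> {}"
      by blast
    moreover have "convex S" if "S \<in> (\<lambda>i. effective_domain (f i)) ` I" for S
      using that insert.prems convex_effective_domain by blast
    ultimately show ?thesis
      using convex_rel_interior_finite_Inter[of "(\<lambda>i. effective_domain (f i)) ` I"] insert.hyps(1)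
      unfolding image_image by blast
  qed
  then have "z \<in> rel_interior (effective_domain (\<lambda>x. \<Sum>i\<in>I. f i x))"
    using insert by (simp add: dom)
  then have "subdifferential (\<lambda>x. f i x + (\<Sum>i\<in>I. f i x)) a
      = subdifferential (f i) a + subdifferential (\<lambda>x. \<Sum>i\<in>I. f i x) a"
    using insert.prems
    by (intro subdifferential_add convex_ereal_sum sum_ereal_neq_MInfty) (simp_all add: dom)
  then show ?case
    using insert by simp
qed

theorem theorem6p2:
  fixes f :: "nat \<Rightarrow> real ^ 'n \<Rightarrow> ereal" and m :: nat and xbar :: "real ^ 'n"
  assumes "m \<ge> 2"
    and "\<And>i x. i \<in> {1..m} \<Longrightarrow> f i x \<noteq> -\<infinity>"
    and "\<And>i. i \<in> {1..m} \<Longrightarrow> convex_ereal (f i)"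
    and "(\<Inter>i\<in>{1..m}. rel_interior (effective_domain (f i))) \<noteq> {}"
    and "xbar \<in> (\<Inter>i\<in>{1..m}. effective_domain (f i))"
  shows "subdifferential (\<lambda>x. \<Sum>i=1..m. f i x) xbar = (\<Sum>i=1..m. subdifferential (f i) xbar)"
proof -
  obtain z where "z \<in> (\<Inter>i\<in>{1..m}. rel_interior (effective_domain (f i)))"
    using assms(4) by blast
  then show ?thesis
    using assms by (intro subdifferential_sum[where z = z]) auto
qed

end
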